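(* Let $m=2h+1$ be a positive odd integer, $q=3^m$ and $\alpha=3^{(m+1)/2}$. Then for each integer $a$ with $0\le a\le q-2$, $$s(a)+s\!\left(\frac{q-1}{2}-a(\alpha+2)\right)\ge m.$$
   Context: For an integer $a$ not divisible by $q-1$, let $L(a)$ be the least positive integer congruent to $a$ modulo $q-1$, write $L(a)=a_0+a_1 3+\cdots+a_{m-1}3^{m-1}$ with $0\le a_i\le 2$, and define the digit sum $s(a)=a_0+a_1+\cdots+a_{m-1}$. For integers $a$ divisible by $q-1$, set $s(a)=0$. *)

theory Defs
  imports "HOL-Number_Theory.Number_Theory"
begin

definition L :: "nat \<Rightarrow> int \<Rightarrow> nat" where
  "L m a = (LEAST n. 0 < n \<and> [int n = a] (mod (3 ^ m - 1)))"

definition ternary_digit :: "nat \<Rightarrow> nat \<Rightarrow> nat" where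
  "ternary_digit n i = (n div 3 ^ i) mod 3"

definition s :: "nat \<Rightarrow> int \<Rightarrow> nat" where
  "s m a = (if (3 ^ m - 1) dvd a then 0 else \<Sum>i<m. ternary_digit (L m a) i)"

lemma ternary_digit_le: "ternary_digit n i \<le> 2"
proof -
  have "ternary_digit n i < 3" unfolding ternary_digit_def by (rule mod_less_divisor) simp
  then show ?thesis by linarith
qed

lemma sum_ternary_digits:
  assumes "n < 3 ^ m"
  shows "(\<Sum>i<m. ternary_digit n i * 3 ^ i) = n"
proof -
  have "(\<Sum>i<m. ternary_digit n i * 3 ^ i) = n mod 3 ^ m"
  proof (induction m)
    case (Suc m)
    have "n mod 3 ^ Suc m = 3 ^ m * (n div 3 ^ m mod 3) + n mod 3 ^ m"
      unfolding power_Suc2 by (rule mod_mult2_eq)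
    with Suc show ?case by (simp add: ternary_digit_def)
  qed simp
  with assms show ?thesis by simp
qed

lemma L_eq_mod:
  assumes "0 < m" and "\<not> (3 ^ m - 1) dvd a"
  shows "L m a = nat (a mod (3 ^ m - 1))"
proof -
  define k :: int where "k = 3 ^ m - 1"
  have k: "k > 0" unfolding k_def using assms(1) by simp
  have "a mod k \<noteq> 0" using assms(2) unfolding k_def by (simp add: dvd_eq_mod_eq_0)
  then have pos: "a mod k > 0" using k by (simp add: order_less_le)
  have "(LEAST n. 0 < n \<and> [int n = a] (mod k)) = nat (a mod k)"
  proof (rule Least_equality)
    show "0 < nat (a mod k) \<and> [int (nat (a mod k)) = a] (mod k)"
      using pos by (simp add: cong_def)
  next
    fix n :: nat
    assume n: "0 < n \<and> [int n = a] (mod k)"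
    have "a mod k = int n mod k" using n by (simp add: cong_def)
    also have "\<dots> \<le> int n" using k by (intro zmod_le_nonneg_dividend) simp
    finally show "nat (a mod k) \<le> n" by simp
  qed
  then show ?thesis unfolding L_def k_def .
qed

end

theory Submission
  imports Defs
begin

text \<open>
  Let \<open>a\<^sub>i\<close> and \<open>b\<^sub>i\<close> be the cyclic ternary digits of \<open>a\<close> and of
  \<open>(q - 1) div 2 - a * (\<alpha> + 2)\<close>. Adding with carries modulo \<open>q - 1\<close> gives integers \<open>c\<^sub>i\<close>
  with \<open>3 c\<^sub>i = 2 a\<^sub>i + a\<^bsub>i-h-1\<^esub> + b\<^sub>i + c\<^bsub>i-1\<^esub> - 1\<close>, indices modulo \<open>m\<close>. Summing over \<open>i\<close>,
  the theorem becomes \<open>\<Sum> c\<^sub>i \<ge> \<Sum> a\<^sub>i\<close>. Since \<open>2 (h + 1) = m + 1\<close>, reading the indices along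
  multiples of \<open>h + 1\<close> turns the recurrence into the local one
  \<open>3 C\<^sub>j = 2 A\<^sub>j + A\<^bsub>j-1\<^esub> + B\<^sub>j + C\<^bsub>j-2\<^esub> - 1\<close>. Here \<open>C\<^sub>j - A\<^sub>j\<close> can be negative, but it
  is bounded below by \<open>\<psi>\<^bsub>j-1\<^esub> - \<psi>\<^sub>j\<close>, where \<open>\<psi>\<^sub>j\<close> is the indicator of \<open>C\<^sub>j \<ge> 1\<close> and
  \<open>A\<^sub>j + C\<^bsub>j-1\<^esub> \<ge> 2\<close>; these bounds telescope around the cycle.
\<close>

lemma periodic_add_mult:
  fixes f :: "nat \<Rightarrow> 'a"
  assumes "\<And>i. f (i + m) = f i"
  shows "f (i + k * m) = f i"
proof (induction k)
  case (Suc k)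
  have "f (i + Suc k * m) = f ((i + k * m) + m)" by (simp add: algebra_simps)
  with Suc show ?case using assms by metis
qed simp

lemma periodic_mod:
  fixes f :: "nat \<Rightarrow> 'a"
  assumes "\<And>i. f (i + m) = f i"
  shows "f (i mod m) = f i"
  using periodic_add_mult[of f m "i mod m" "i div m", OF assms] by simp

text \<open>Multiplication by a unit \<open>k\<close> and translation by \<open>r\<close> permute
  the residues modulo \<open>m\<close>.\<close>

lemma sum_periodic_coprime:
  fixes f :: "nat \<Rightarrow> 'a :: comm_monoid_add"
  assumes per: "\<And>i. f (i + m) = f i" and "coprime k m" and "0 < m"
  shows "(\<Sum>j<m. f (j * k + r)) = (\<Sum>i<m. f i)"
proof -
  let ?g = "\<lambda>j. (j * k + r) mod m"
  have inj: "inj_on ?g {..<m}"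
  proof (rule inj_onI)
    fix x y assume xy: "x \<in> {..<m}" "y \<in> {..<m}" "?g x = ?g y"
    then have "[x * k + r = y * k + r] (mod m)" by (simp add: cong_def)
    then have "[x = y] (mod m)"
      using assms(2) by (simp add: cong_add_rcancel_nat cong_mult_rcancel_nat)
    with xy show "x = y" by (simp add: cong_def)
  qed
  moreover have "?g ` {..<m} \<subseteq> {..<m}" using assms(3) by auto
  ultimately have "bij_betw ?g {..<m} {..<m}"
    by (simp add: bij_betw_def endo_inj_surj)
  then have "(\<Sum>j<m. f (?g j)) = (\<Sum>i<m. f i)" by (rule sum.reindex_bij_betw)
  then show ?thesis by (simp add: periodic_mod[of f m, OF per])
qed

text \<open>As \<open>b ^ m\<close> is 1 modulo \<open>b ^ m - 1\<close>, each factor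
  \<open>b\<close> just rotates the \<open>m\<close> digits by one place.\<close>

lemma cyclic_shift_cong:
  fixes f :: "nat \<Rightarrow> int" and b :: int
  assumes per: "\<And>i. f (i + m) = f i"
  shows "[b ^ k * (\<Sum>i<m. f (i + k) * b ^ i) = (\<Sum>i<m. f i * b ^ i)] (mod (b ^ m - 1))"
proof (induction k)
  case (Suc k)
  let ?S = "\<lambda>k. \<Sum>i<m. f (i + k) * b ^ i"
  have "?S k + f (m + k) * b ^ m = f k + (\<Sum>i<m. f (Suc i + k) * b ^ Suc i)"
    using sum.lessThan_Suc_shift[of "\<lambda>i. f (i + k) * b ^ i" m] by simp
  also have "(\<Sum>i<m. f (Suc i + k) * b ^ Suc i) = b * ?S (Suc k)"
    by (simp add: sum_distrib_left mult_ac)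
  finally have "b * ?S (Suc k) = ?S k + f k * (b ^ m - 1)"
    using per[of k] by (simp add: algebra_simps)
  then have "b ^ Suc k * ?S (Suc k) = b ^ k * ?S k + b ^ k * f k * (b ^ m - 1)"
    by (simp only: power_Suc2 mult.assoc distrib_left)
  then have "[b ^ Suc k * ?S (Suc k) = b ^ k * ?S k] (mod (b ^ m - 1))"
    by (simp add: cong_iff_dvd_diff)
  then show ?case using Suc by (rule cong_trans)
qed simp

text \<open>Ordinary carrying, started from the one carry \<open>c0\<close> that reappears after
  \<open>m\<close> positions; the carry into position \<open>i\<close> is
  \<open>(P i + c0) div b ^ i\<close>.\<close>

lemma cyclic_carries:
  fixes x :: "nat \<Rightarrow> int" and b :: int
  assumes per: "\<And>i. x (i + m) = x i" and "0 < m" and "b \<noteq> 0"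
    and dvd: "(b ^ m - 1) dvd (\<Sum>i<m. x i * b ^ i)"
  obtains c :: "nat \<Rightarrow> int"
  where "\<And>i. c (i + m) = c i" and "\<And>i. b * c (Suc i) = x i + c i"
proof -
  define P where "P n = (\<Sum>i<n. x i * b ^ i)" for n
  obtain c0 where c0: "P m = (b ^ m - 1) * c0" using dvd unfolding P_def by (elim dvdE)
  have P_add: "P (n + k) = P n + b ^ n * (\<Sum>i<k. x (i + n) * b ^ i)" for n k
    unfolding P_def by (induction k) (simp_all add: algebra_simps power_add)
  have P_per: "P (i + m) + c0 = b ^ m * (P i + c0)" for i
  proof -
    have "P (m + i) = P m + b ^ m * P i" unfolding P_add by (simp only: per P_def)
    then show ?thesis unfolding c0 by (simp add: add.commute algebra_simps)
  qed
  have P_mult: "P (k * m) + c0 = b ^ (k * m) * c0" for k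
  proof (induction k)
    case (Suc k)
    then show ?case using P_per[of "k * m"] by (simp add: power_add add.commute)
  qed (simp add: P_def)
  have P_dvd: "b ^ i dvd P i + c0" for i
  proof -
    \<comment> \<open>\<open>P_mult\<close> yields divisibility only at multiples of
      \<open>m\<close>. It passes from \<open>i * m\<close> down to \<open>i\<close> because
      \<open>P (i * m)\<close> and \<open>P i\<close> agree modulo \<open>b ^ i\<close>.\<close>
    have le: "i \<le> i * m" using \<open>0 < m\<close> by simp
    then have "P (i * m) = P i + b ^ i * (\<Sum>j<i * m - i. x (j + i) * b ^ j)"
      using P_add[of i "i * m - i"] by simp
    moreover have "b ^ i dvd P (i * m) + c0"
      unfolding P_mult using le by (intro dvd_mult2 le_imp_power_dvd)
    ultimately show ?thesis
      by (simp add: add.commute[of _ c0] add.assoc[symmetric] dvd_add_left_iff)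
  qed
  define c where "c i = (P i + c0) div b ^ i" for i
  have c: "P i + c0 = b ^ i * c i" for i
    using P_dvd[of i] by (simp add: c_def)
  show thesis
  proof (rule that)
    fix i
    have "b ^ (i + m) * c (i + m) = b ^ (i + m) * c i"
      using P_per[of i] unfolding c by (simp add: power_add mult_ac)
    then show "c (i + m) = c i" using \<open>b \<noteq> 0\<close> by simp
    have "P (Suc i) + c0 = x i * b ^ i + (P i + c0)" by (simp add: P_def)
    then have "b ^ i * (b * c (Suc i)) = b ^ i * (x i + c i)"
      unfolding c by (simp add: algebra_simps)
    then show "b * c (Suc i) = x i + c i" using \<open>b \<noteq> 0\<close> by simp
  qed
qed

text \<open>A negative carry would force the preceding ones to decrease strictly all around the cycle.\<close>

lemma cyclic_carries_nonneg:
  fixes c x :: "nat \<Rightarrow> int"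
  assumes per: "\<And>i. c (i + m) = c i" and "0 < m"
    and rec: "\<And>i. 3 * c (Suc i) = x i + c i" and x: "\<And>i. - 1 \<le> x i"
  shows "0 \<le> c i"
proof (rule ccontr)
  assume "\<not> 0 \<le> c i"
  have "c (i + k) < 0 \<Longrightarrow> c i \<le> c (i + k) - int k" for k
  proof (induction k)
    case (Suc k)
    then show ?case using rec[of "i + k"] x[of "i + k"] by simp
  qed simp
  from this[of m] show False using \<open>\<not> 0 \<le> c i\<close> \<open>0 < m\<close> per[of i] by simp
qed

lemma sum_cyclic_recurrence_ge:
  fixes A B C :: "nat \<Rightarrow> int"
  assumes perA: "\<And>j. A (j + m) = A j" and perC: "\<And>j. C (j + m) = C j" and "0 < m"
    and A: "\<And>j. 0 \<le> A j \<and> A j \<le> 2" and B: "\<And>j. 0 \<le> B j" and C: "\<And>j. 0 \<le> C j"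
    and rec: "\<And>j. 3 * C (j + 2) = 2 * A (j + 2) + A (j + 1) + B (j + 2) + C j - 1"
  shows "(\<Sum>j<m. A j) \<le> (\<Sum>j<m. C j)"
proof -
  \<comment> \<open>The index is one lower than in the overview, so that no predecessor of 0
    occurs.\<close>
  define \<psi> :: "nat \<Rightarrow> int" where
    "\<psi> j = (if C (j + 1) \<ge> 1 \<and> A (j + 1) + C j \<ge> 2 then 1 else 0)" for j
  \<comment> \<open>Split on \<open>A (j + 2)\<close>. If it is 0, \<open>\<psi> j = 1\<close> makes
    the right side of \<open>rec\<close> positive. If it is 1, \<open>C (j + 2)\<close> is at least
    1, and \<open>\<psi> j = 1\<close> implies \<open>\<psi> (Suc j) = 1\<close>. If it is 2,
    \<open>\<psi> (Suc j) = 1\<close>, and \<open>C (j + 2) = 1\<close> forces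
    \<open>A (j + 1) = C j = 0\<close>, so \<open>\<psi> j = 0\<close>.\<close>
  have step: "\<psi> j - \<psi> (Suc j) \<le> C (j + 2) - A (j + 2)" for j
    using rec[of j] A[of "j + 1"] A[of "j + 2"] B[of "j + 2"] C[of j] C[of "j + 1"]
    unfolding \<psi>_def by auto
  have "\<psi> m = \<psi> 0"
    using perA[of 1] perC[of 1] perC[of 0] by (simp add: \<psi>_def add.commute)
  then have "0 = (\<Sum>j<m. \<psi> j - \<psi> (Suc j))" by (simp add: sum_lessThan_telescope')
  also have "\<dots> \<le> (\<Sum>j<m. C (j + 2) - A (j + 2))" using step by (rule sum_mono)
  also have "\<dots> = (\<Sum>j<m. C j) - (\<Sum>j<m. A j)"
    using sum_periodic_coprime[of C m 1 2, OF perC] sum_periodic_coprime[of A m 1 2, OF perA]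
      \<open>0 < m\<close> by (simp add: sum_subtractf)
  finally show ?thesis by simp
qed

text \<open>The least nonnegative residue of \<open>a\<close> serves both branches of
  \<open>s\<close>: it equals \<open>L m a\<close> if nonzero, and otherwise all its digits
  vanish.\<close>

lemma s_cyclic_digits:
  fixes a :: int
  assumes "0 < m"
  obtains d :: "nat \<Rightarrow> int"
  where "\<And>i. d (i + m) = d i" and "\<And>i. 0 \<le> d i \<and> d i \<le> 2"
    and "[(\<Sum>i<m. d i * 3 ^ i) = a] (mod (3 ^ m - 1))" and "int (s m a) = (\<Sum>i<m. d i)"
proof -
  define n where "n = nat (a mod (3 ^ m - 1))"
  have pos: "(3 :: int) ^ m - 1 > 0" using assms by simp
  then have n: "int n = a mod (3 ^ m - 1)" by (simp add: n_def)
  then have "int n < 3 ^ m" using pos_mod_bound[OF pos, of a] by simp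
  then have "n < 3 ^ m" by (metis of_nat_less_iff of_nat_numeral of_nat_power)
  then have "(\<Sum>i<m. ternary_digit n i * 3 ^ i) = n" by (rule sum_ternary_digits)
  then have "int (\<Sum>i<m. ternary_digit n i * 3 ^ i) = int n" by simp
  then have sum: "(\<Sum>i<m. int (ternary_digit n i) * 3 ^ i) = int n" by simp
  have "s m a = (\<Sum>i<m. ternary_digit n i)"
  proof (cases "(3 ^ m - 1) dvd a")
    case True
    then have "n = 0" by (simp add: n_def)
    with True show ?thesis by (simp add: s_def ternary_digit_def)
  next
    case False
    then show ?thesis using assms by (simp add: s_def L_eq_mod n_def)
  qed
  then show thesis
    using sum n ternary_digit_le
    by (intro that[of "\<lambda>i. int (ternary_digit n (i mod m))"]) (simp_all add: cong_def)
qed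

theorem theorem6p1:
  fixes m h :: nat and q \<alpha> a :: int
  assumes "m = 2 * h + 1"
    and "q = 3 ^ m"
    and "\<alpha> = 3 ^ ((m + 1) div 2)"
    and "0 \<le> a" and "a \<le> q - 2"
  shows "s m a + s m ((q - 1) div 2 - a * (\<alpha> + 2)) \<ge> m"
proof -
  have m: "0 < m" using assms(1) by simp
  have \<alpha>: "\<alpha> = 3 ^ (h + 1)" using assms(1,3) by simp
  define e where "e = (q - 1) div 2 - a * (\<alpha> + 2)"
  obtain d where d_per: "\<And>i. d (i + m) = d i" and d: "\<And>i. 0 \<le> d i \<and> d i \<le> 2"
    and d_sum: "[(\<Sum>i<m. d i * 3 ^ i) = a] (mod (3 ^ m - 1))"
    and s_d: "int (s m a) = (\<Sum>i<m. d i)"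
    using s_cyclic_digits[OF m] by blast
  obtain f where f_per: "\<And>i. f (i + m) = f i" and f: "\<And>i. 0 \<le> f i \<and> f i \<le> 2"
    and f_sum: "[(\<Sum>i<m. f i * 3 ^ i) = e] (mod (3 ^ m - 1))"
    and s_f: "int (s m e) = (\<Sum>i<m. f i)"
    using s_cyclic_digits[OF m] by blast
  \<comment> \<open>Digitwise form of \<open>2 * a + \<alpha> * a + e - (q - 1) div 2 = 0\<close>.
    Multiplying by \<alpha> shifts indices by \<open>-(h + 1)\<close>, which is \<open>h\<close>
    modulo \<open>m\<close>; all \<open>m\<close> digits of \<open>(q - 1) div 2\<close> are
    1.\<close>
  define x where "x i = 2 * d i + d (i + h) + f i - 1" for i
  have x_per: "x (i + m) = x i" for i
    using d_per[of i] d_per[of "i + h"] f_per[of i] by (simp add: x_def add_ac)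
  have "(3 ^ m - 1) dvd (\<Sum>i<m. x i * 3 ^ i)"
  proof -
    let ?D = "\<Sum>i<m. d i * 3 ^ i" and ?D' = "\<Sum>i<m. d (i + h) * 3 ^ i"
    have "[3 ^ (h + 1) * (3 ^ h * ?D') = 3 ^ (h + 1) * a] (mod (3 ^ m - 1))"
      using cyclic_shift_cong[of d m 3 h, OF d_per] d_sum
      by (intro cong_scalar_left) (rule cong_trans)
    moreover have "(3 :: int) ^ (h + 1) * 3 ^ h = 3 ^ m"
      unfolding power_add[symmetric] by (simp add: assms(1) mult_2)
    then have "3 ^ (h + 1) * (3 ^ h * ?D') = 3 ^ m * ?D'"
      by (simp only: mult.assoc[symmetric])
    moreover have "[3 ^ m * ?D' = ?D'] (mod (3 ^ m - 1))"
      using cong_scalar_right[of "3 ^ m" 1 "3 ^ m - 1" ?D'] by (simp add: cong_iff_dvd_diff)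
    ultimately have D': "[?D' = \<alpha> * a] (mod (3 ^ m - 1))"
      unfolding \<alpha> by (simp only: cong_def)
    have "odd (3 ^ m :: int)" by simp
    then have half: "2 * ((q - 1) div 2) = q - 1" using assms(2) by simp
    have "(\<Sum>i<m. (3 :: int) ^ i) * 2 = 3 ^ m - 1"
      by (induction m) simp_all
    with half have ones: "(\<Sum>i<m. (3 :: int) ^ i) = (q - 1) div 2" using assms(2) by simp
    have "(\<Sum>i<m. x i * 3 ^ i) = 2 * ?D + ?D' + (\<Sum>i<m. f i * 3 ^ i) - (q - 1) div 2"
      unfolding ones[symmetric] x_def
      by (simp add: sum.distrib sum_subtractf sum_distrib_left algebra_simps)
    moreover have "[2 * ?D + ?D' + (\<Sum>i<m. f i * 3 ^ i) - (q - 1) div 2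
        = 2 * a + \<alpha> * a + e - (q - 1) div 2] (mod (3 ^ m - 1))"
      by (intro cong_add cong_diff cong_scalar_left d_sum D' f_sum cong_refl)
    moreover have "2 * a + \<alpha> * a + e - (q - 1) div 2 = 0"
      by (simp add: e_def algebra_simps)
    ultimately show ?thesis by (simp add: cong_0_iff)
  qed
  then obtain c where c_per: "\<And>i. c (i + m) = c i" and c: "\<And>i. 3 * c (Suc i) = x i + c i"
    using cyclic_carries[of x m 3, OF x_per m] by auto
  have "- 1 \<le> x i" for i
    using d[of i] d[of "i + h"] f[of i] by (simp add: x_def)
  then have c_nonneg: "0 \<le> c i" for i
    by (rule cyclic_carries_nonneg[of c m x, OF c_per m c])
  have coprime: "coprime (h + 1) m"
  proof -
    have "gcd (h + (h + 1)) (h + 1) = gcd h (h + 1)" by (rule gcd_add1)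
    also have "\<dots> = 1" by simp
    finally have "gcd m (h + 1) = 1" by (simp add: assms(1) mult_2)
    then show ?thesis by (simp only: coprime_iff_gcd_eq_1 gcd.commute)
  qed
  note perm = sum_periodic_coprime[OF _ coprime m]
  have mult_per: "g ((j + m) * (h + 1) + r) = g (j * (h + 1) + r)"
    if "\<And>i. g (i + m) = g i" for g :: "nat \<Rightarrow> int" and j r
    using periodic_add_mult[of g m "j * (h + 1) + r" "h + 1", OF that]
    by (simp add: algebra_simps)
  \<comment> \<open>The offset 1 on \<open>c\<close> selects the carry out of a position rather than
    into it. Two steps of \<open>h + 1\<close> advance by one position modulo \<open>m\<close>, and
    adding \<open>h\<close> undoes one step.\<close>
  have "(\<Sum>j<m. d (j * (h + 1) + 0)) \<le> (\<Sum>j<m. c (j * (h + 1) + 1))"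
  proof (rule sum_cyclic_recurrence_ge[where B = "\<lambda>j. f (j * (h + 1))"])
    fix j
    let ?i = "(j + 2) * (h + 1)"
    have "?i + h = (j + 1) * (h + 1) + 0 + m" and "?i = j * (h + 1) + 1 + m"
      by (simp_all add: assms(1) algebra_simps)
    then have "d (?i + h) = d ((j + 1) * (h + 1) + 0)" and "c ?i = c (j * (h + 1) + 1)"
      using d_per c_per by metis+
    then show "3 * c (?i + 1) = 2 * d (?i + 0) + d ((j + 1) * (h + 1) + 0) + f ?i
        + c (j * (h + 1) + 1) - 1"
      using c[of ?i] by (simp add: x_def)
  qed (use mult_per[of d, OF d_per] mult_per[of c, OF c_per] d f c_nonneg m in blast)+
  then have ge: "(\<Sum>i<m. d i) \<le> (\<Sum>i<m. c i)"
    unfolding perm[of d, OF d_per] perm[of c, OF c_per] .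
  have shift: "(\<Sum>i<m. g (i + r)) = (\<Sum>i<m. g i)"
    if "\<And>i. g (i + m) = g i" for g :: "nat \<Rightarrow> int" and r
    using sum_periodic_coprime[of g m 1 r, OF that] m by simp
  \<comment> \<open>Summing the carry recurrence expresses the carry total through the two digit
    sums; \<open>ge\<close> then bounds it below.\<close>
  have "3 * (\<Sum>i<m. c (i + 1)) = (\<Sum>i<m. x i) + (\<Sum>i<m. c i)"
    by (simp add: sum_distrib_left c sum.distrib)
  also have "(\<Sum>i<m. x i) = 2 * (\<Sum>i<m. d i) + (\<Sum>i<m. d (i + h)) + (\<Sum>i<m. f i) - int m"
    by (simp add: x_def sum.distrib sum_subtractf sum_distrib_left)
  finally have "2 * (\<Sum>i<m. c i) = 3 * (\<Sum>i<m. d i) + (\<Sum>i<m. f i) - int m"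
    unfolding shift[of c, OF c_per] shift[of d, OF d_per] by simp
  with ge have "int m \<le> int (s m a) + int (s m e)" unfolding s_d s_f by simp
  then show ?thesis unfolding e_def by linarith
qed

end
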